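(* Let $\mathbf{F}$ be a field of characteristic zero, $P=\mathbf{F}[x]$, let $\psi$ be an admissible sequence in $\mathbf{F}$, let $Q(\partial_\psi):P\to P$ be a $\partial_\psi$-delta operator, and let $\hat{x}_{Q(\partial_\psi)}:P\to P$ be the operator dual to $Q(\partial_\psi)$. Let $\{q_n\}_{n\ge 0}$ be an arbitrary sequence of polynomials in one variable over $\mathbf{F}$ (no condition on degrees). Then $$T=\sum_{n\ge 0} q_n\big(\hat{x}_{Q(\partial_\psi)}\big)\,Q(\partial_\psi)^n$$ defines a linear operator that maps polynomials into polynomials. Conversely, if $T:P\to P$ is a linear operator, then there exists a unique expansion of the form $$T=\sum_{n\ge 0} q_n\big(\hat{x}_{Q(\partial_\psi)}\big)\,Q(\partial_\psi)^n ,$$ i.e. there is a unique sequence $\{q_n\}_{n\ge0}$ of polynomials over $\mathbf{F}$ for which this equality holds.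
   Context: All operators are $\mathbf{F}$-linear maps on $P=\mathbf{F}[x]$, where $\mathbf{F}$ is a field of characteristic zero. An infinite sum of operators is understood pointwise: applied to any given polynomial, only finitely many terms are nonzero. An admissible sequence is $\psi=\{\psi_n\}_{n\ge 0}$ with $\psi_n\in\mathbf{F}$, $\psi_n\neq 0$ for all $n\ge 0$, and $\psi_0=1$; by convention $\psi_{-n}=0$ for $n\ge1$. Put $n_\psi=\psi_{n-1}\psi_n^{-1}$ for $n\ge 0$ (so $0_\psi=0$ and $n_\psi\ne0$ for $n\ge1$) and $n_\psi!=\psi_n^{-1}=n_\psi(n-1)_\psi\cdots 1_\psi$, $0_\psi!=1$. The $\psi$-derivative $\partial_\psi:P\to P$ is the linear operator with $\partial_\psi x^n=n_\psi x^{n-1}$, $n\ge 0$. The generalized translation operator is $E^{a}(\partial_\psi)=\sum_{k\ge 0}\frac{a^k\partial_\psi^k}{k_\psi!}$, $a\in\mathbf{F}$. A linear operator $T$ on $P$ is $\partial_\psi$-shift invariant if $T E^{a}(\partial_\psi)=E^{a}(\partial_\psi)T$ for all $a\in\mathbf{F}$. A $\partial_\psi$-delta operator $Q(\partial_\psi):P\to P$ is a $\partial_\psi$-shift invariant linear operator such that $Q(\partial_\psi)x$ is a nonzero constant. Its $\partial_\psi$-basic polynomial sequence is the polynomial sequence $\{p_n\}_{n\ge 0}$, $\deg p_n=n$, with $p_0(x)=1$, $p_n(0)=0$ for $n>0$, and $Q(\partial_\psi)p_n=n_\psi p_{n-1}$. The operator $\hat{x}_{Q(\partial_\psi)}$ dual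 to $Q(\partial_\psi)$ is the linear map $P\to P$ defined by $\hat{x}_{Q(\partial_\psi)}p_n=\frac{n+1}{(n+1)_\psi}p_{n+1}$, $n\ge 0$. *)

theory Defs
  imports "HOL-Computational_Algebra.Polynomial" "HOL-Library.Groups_Big_Fun"
begin

abbreviation linear_op :: "('a::field poly \<Rightarrow> 'a poly) \<Rightarrow> bool" where
  "linear_op \<equiv> Vector_Spaces.linear smult smult"

text \<open>
  Linear extension of an assignment on the monomial basis: \<open>x\<^sup>n\<close> is sent to \<open>f n\<close>.
\<close>
definition monom_extend :: "(nat \<Rightarrow> 'a::field poly) \<Rightarrow> 'a poly \<Rightarrow> 'a poly" where
  "monom_extend f p = (\<Sum>i\<le>degree p. smult (coeff p i) (f i))"

text \<open>
  Infinite sums of operators are pointwise finite. Since \<^const>\<open>Sum_any\<close> returns 0 on a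
  family with infinite support, \<open>op_sum A\<close> is meaningful only together with \<open>op_summable A\<close>.
\<close>
definition op_summable :: "(nat \<Rightarrow> 'a::field poly \<Rightarrow> 'a poly) \<Rightarrow> bool" where
  "op_summable A \<longleftrightarrow> (\<forall>p. finite {n. A n p \<noteq> 0})"

definition op_sum :: "(nat \<Rightarrow> 'a::field poly \<Rightarrow> 'a poly) \<Rightarrow> 'a poly \<Rightarrow> 'a poly" where
  "op_sum A p = Sum_any (\<lambda>n. A n p)"

text \<open>The operator \<open>q(X)\<close> obtained by substituting an operator \<open>X\<close> into a polynomial \<open>q\<close>.\<close>
definition poly_op :: "'a::field poly \<Rightarrow> ('a poly \<Rightarrow> 'a poly) \<Rightarrow> 'a poly \<Rightarrow> 'a poly" where
  "poly_op q X p = (\<Sum>i\<le>degree q. smult (coeff q i) ((X ^^ i) p))"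

definition admissible :: "(nat \<Rightarrow> 'a::field) \<Rightarrow> bool" where
  "admissible \<psi> \<longleftrightarrow> \<psi> 0 = 1 \<and> (\<forall>n. \<psi> n \<noteq> 0)"

text \<open>
  \<open>n\<^sub>\<psi> = \<psi>\<^bsub>n-1\<^esub> / \<psi>\<^sub>n\<close>; the case \<open>n = 0\<close> comes from the convention \<open>\<psi>\<^bsub>-1\<^esub> = 0\<close>.
\<close>
definition psi_num :: "(nat \<Rightarrow> 'a::field) \<Rightarrow> nat \<Rightarrow> 'a" where
  "psi_num \<psi> n = (if n = 0 then 0 else \<psi> (n - 1) / \<psi> n)"

definition psi_fact :: "(nat \<Rightarrow> 'a::field) \<Rightarrow> nat \<Rightarrow> 'a" where
  "psi_fact \<psi> n = (\<Prod>k=1..n. psi_num \<psi> k)"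

lemma psi_fact_eq_inverse:
  assumes "admissible \<psi>"
  shows "psi_fact \<psi> n = inverse (\<psi> n)"
proof (induction n)
  case 0
  show ?case using assms by (simp add: psi_fact_def admissible_def)
next
  case (Suc n)
  have "psi_fact \<psi> (Suc n) = psi_fact \<psi> n * psi_num \<psi> (Suc n)"
    by (simp add: psi_fact_def)
  then show ?case using Suc assms
    by (simp add: psi_num_def admissible_def field_simps)
qed

definition psi_deriv :: "(nat \<Rightarrow> 'a::field) \<Rightarrow> 'a poly \<Rightarrow> 'a poly" where
  "psi_deriv \<psi> = monom_extend (\<lambda>n. monom (psi_num \<psi> n) (n - 1))"

definition psi_translation :: "(nat \<Rightarrow> 'a::field) \<Rightarrow> 'a \<Rightarrow> 'a poly \<Rightarrow> 'a poly" where
  "psi_translation \<psi> a = op_sum (\<lambda>k p. smult (a ^ k / psi_fact \<psi> k) ((psi_deriv \<psi> ^^ k) p))"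

definition psi_shift_invariant ::
    "(nat \<Rightarrow> 'a::field) \<Rightarrow> ('a poly \<Rightarrow> 'a poly) \<Rightarrow> bool" where
  "psi_shift_invariant \<psi> T \<longleftrightarrow>
     linear_op T \<and> (\<forall>a. T \<circ> psi_translation \<psi> a = psi_translation \<psi> a \<circ> T)"

definition psi_delta_operator ::
    "(nat \<Rightarrow> 'a::field) \<Rightarrow> ('a poly \<Rightarrow> 'a poly) \<Rightarrow> bool" where
  "psi_delta_operator \<psi> Q \<longleftrightarrow>
     psi_shift_invariant \<psi> Q \<and> (\<exists>c. c \<noteq> 0 \<and> Q [:0, 1:] = [:c:])"

text \<open>
  For \<open>n = 0\<close> the last equation reads \<open>Q p\<^sub>0 = 0\<close>, as the factor \<open>0\<^sub>\<psi> = 0\<close> hides the index \<open>0 - 1\<close>.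
\<close>
definition is_psi_basic_seq ::
    "(nat \<Rightarrow> 'a::field) \<Rightarrow> ('a poly \<Rightarrow> 'a poly) \<Rightarrow> (nat \<Rightarrow> 'a poly) \<Rightarrow> bool" where
  "is_psi_basic_seq \<psi> Q p \<longleftrightarrow>
     (\<forall>n. degree (p n) = n) \<and> p 0 = 1 \<and> (\<forall>n>0. poly (p n) 0 = 0) \<and>
     (\<forall>n. Q (p n) = smult (psi_num \<psi> n) (p (n - 1)))"

text \<open>
  A delta operator has exactly one basic sequence, and that sequence is a basis of the space of
  polynomials, so both definite descriptions below are proper whenever \<open>Q\<close> is a delta operator
  and \<open>\<psi>\<close> is admissible.
\<close>
definition psi_basic_seq ::
    "(nat \<Rightarrow> 'a::field) \<Rightarrow> ('a poly \<Rightarrow> 'a poly) \<Rightarrow> nat \<Rightarrow> 'a poly" where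
  "psi_basic_seq \<psi> Q = (THE p. is_psi_basic_seq \<psi> Q p)"

definition dual_op ::
    "(nat \<Rightarrow> 'a::field) \<Rightarrow> ('a poly \<Rightarrow> 'a poly) \<Rightarrow> 'a poly \<Rightarrow> 'a poly" where
  "dual_op \<psi> Q = (THE X. linear_op X \<and>
     (\<forall>n. X (psi_basic_seq \<psi> Q n) =
            smult (of_nat (n + 1) / psi_num \<psi> (n + 1)) (psi_basic_seq \<psi> Q (n + 1))))"

lemma linear_op_iff:
  "linear_op T \<longleftrightarrow> (\<forall>p r. T (p + r) = T p + T r) \<and> (\<forall>c p. T (smult c p) = smult c (T p))"
proof -
  have "vector_space (smult :: 'a::field \<Rightarrow> 'a poly \<Rightarrow> 'a poly)"
    by unfold_locales (simp_all add: smult_add_right smult_add_left)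
  then show ?thesis
    by (simp add: Vector_Spaces.linear_iff)
qed

lemma monom_extend_monom [simp]: "monom_extend f (monom 1 n) = f n"
proof -
  have "monom_extend f (monom 1 n) = (\<Sum>i\<le>n. if i = n then f n else 0)"
    unfolding monom_extend_def by (rule sum.cong) (auto simp: degree_monom_eq)
  then show ?thesis by simp
qed

lemma monom_extend_altdef:
  assumes "degree p \<le> N"
  shows "monom_extend f p = (\<Sum>i\<le>N. smult (coeff p i) (f i))"
  unfolding monom_extend_def using assms
  by (intro sum.mono_neutral_left) (auto simp: coeff_eq_0)

lemma linear_monom_extend:
  fixes f :: "nat \<Rightarrow> 'a::field poly"
  shows "linear_op (monom_extend f)"
proof -
  have "monom_extend f (p + r) = monom_extend f p + monom_extend f r" for p r
  proof -
    let ?N = "max (degree p) (degree r)"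
    have "degree (p + r) \<le> ?N" by (rule degree_add_le_max)
    then show ?thesis
      by (simp add: monom_extend_altdef[where N = ?N] smult_add_left sum.distrib)
  qed
  moreover have "monom_extend f (smult c p) = smult c (monom_extend f p)" for c p
  proof -
    have "smult c (\<Sum>i\<in>A. g i) = (\<Sum>i\<in>A. smult c (g i))" for A and g :: "nat \<Rightarrow> 'a poly"
      by (induction A rule: infinite_finite_induct) (simp_all add: smult_add_right)
    then show ?thesis
      by (simp add: monom_extend_altdef[where N = "degree p"] degree_smult_le)
  qed
  ultimately show ?thesis by (simp add: linear_op_iff)
qed

lemma psi_deriv_monom: "psi_deriv \<psi> (monom 1 n) = monom (psi_num \<psi> n) (n - 1)"
  by (simp add: psi_deriv_def)

lemma op_summable_psi_translation:
  "op_summable (\<lambda>k p. smult (a ^ k / psi_fact \<psi> k) ((psi_deriv \<psi> ^^ k) p))"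
proof -
  have vanish: "psi_deriv \<psi> p = 0" if "degree p = 0" for p
    using that by (simp add: psi_deriv_def monom_extend_def psi_num_def)
  have lower: "degree (psi_deriv \<psi> p) \<le> degree p - 1" for p
    unfolding psi_deriv_def monom_extend_def
    by (intro degree_sum_le)
      (auto intro!: order.trans[OF degree_smult_le] order.trans[OF degree_monom_le])
  have deg: "degree ((psi_deriv \<psi> ^^ k) p) \<le> degree p - k" for k p
  proof (induction k)
    case (Suc k)
    show ?case using lower[of "(psi_deriv \<psi> ^^ k) p"] Suc by simp
  qed simp
  have "(psi_deriv \<psi> ^^ k) p = 0" if "k > degree p" for k p
  proof -
    from that obtain j where "k = Suc j" "j \<ge> degree p" by (cases k) auto
    then show ?thesis using deg[of j p] by (auto intro: vanish)
  qed
  then have "{k. smult (a ^ k / psi_fact \<psi> k) ((psi_deriv \<psi> ^^ k) p) \<noteq> 0} \<subseteq> {..degree p}" for p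
    by (force simp: not_less)
  then show ?thesis
    unfolding op_summable_def by (meson finite_atMost finite_subset)
qed

end

(*
  Comparing coefficients of a^k in Q E^a = E^a Q shows that Q commutes with the psi-derivative,
  which forces Q to lower degrees by exactly one and to kill only the constants. Hence Q is
  surjective, and the basic sequence and the dual operator X exist. On a polynomial of degree n
  only the terms up to Q^n contribute, and Q^n sends it to a nonzero constant c. Since X^i c has
  degree i, the map r -> r(X) c is bijective. So the values of T on monomials of degree at most n
  determine q_0, ..., q_n recursively and without constraint.
*)
theory Submission
  imports Defs
begin

section \<open>Linear operators on polynomials and triangular families\<close>

lemma smult_sum_right: "smult c (\<Sum>i\<in>A. g i) = (\<Sum>i\<in>A. smult c (g i))"
  by (induction A rule: infinite_finite_induct) (simp_all add: smult_add_right)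

lemma linear_op_add: "linear_op T \<Longrightarrow> T (p + r) = T p + T r"
  by (simp add: linear_op_iff)

lemma linear_op_smult: "linear_op T \<Longrightarrow> T (smult c p) = smult c (T p)"
  by (simp add: linear_op_iff)

lemma linear_op_0: "linear_op T \<Longrightarrow> T 0 = 0"
  using linear_op_smult[of T 0 0] by simp

lemma linear_op_diff: "linear_op T \<Longrightarrow> T (p - r) = T p - T r"
  using linear_op_add[of T "p - r" r] by (simp add: algebra_simps)

lemma linear_op_sum: "linear_op T \<Longrightarrow> T (\<Sum>i\<in>A. g i) = (\<Sum>i\<in>A. T (g i))"
  by (induction A rule: infinite_finite_induct) (simp_all add: linear_op_add linear_op_0)

lemma linear_op_funpow: "linear_op T \<Longrightarrow> linear_op (T ^^ n)"
  by (induction n) (simp_all add: linear_op_iff)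

lemma poly_eq_sum_monom: "(p :: 'a::comm_semiring_1 poly) = (\<Sum>i\<le>degree p. smult (coeff p i) (monom 1 i))"
  by (simp add: poly_as_sum_of_monoms smult_monom)

lemma linear_op_eqI:
  assumes "linear_op S" "linear_op T" "\<And>n. S (monom 1 n) = T (monom 1 n)"
  shows "S = T"
proof
  fix p
  have "S (\<Sum>i\<le>degree p. smult (coeff p i) (monom 1 i))
      = T (\<Sum>i\<le>degree p. smult (coeff p i) (monom 1 i))"
    by (simp add: assms linear_op_sum linear_op_smult del: smult_monom)
  then show "S p = T p" by (simp flip: poly_eq_sum_monom del: smult_monom)
qed

text \<open>Induction on the degree of the target: a scalar multiple of some value
  \<open>L u\<close> of the same degree cancels its leading term, and the remainder is zero or of
  smaller degree, hence already a value of \<open>L\<close>.\<close>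

lemma linear_op_surjI:
  assumes L: "linear_op L" and hit: "\<And>n. \<exists>u. degree (L u) = n \<and> L u \<noteq> 0"
  shows "surj L"
proof -
  have "\<exists>p. L p = r" for r
  proof (induction "degree r" arbitrary: r rule: less_induct)
    case less
    obtain u where u: "degree (L u) = degree r" "L u \<noteq> 0"
      using hit by blast
    define c where "c = lead_coeff r / lead_coeff (L u)"
    define r' where "r' = r - smult c (L u)"
    have "coeff r' (degree r) = 0"
      using u by (simp add: r'_def c_def flip: u(1))
    moreover have "degree r' \<le> degree r"
      unfolding r'_def using u by (intro degree_diff_le) (auto intro: order.trans[OF degree_smult_le])
    ultimately have "r' = 0 \<or> degree r' < degree r"
      using eq_zero_or_degree_less by blast
    then obtain v where "L v = r'"
      using less linear_op_0[OF L] by metis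
    then have "L (v + smult c u) = r"
      by (simp add: linear_op_add[OF L] linear_op_smult[OF L] r'_def)
    then show ?case by blast
  qed
  then show ?thesis by (metis surjI)
qed

text \<open>A sequence with one polynomial of each degree is a basis, and
  \<open>monom_extend g\<close> is the change of basis from the monomials. The condition on
  \<open>g 0\<close> matters because the zero polynomial also has degree 0.\<close>

lemma bij_monom_extend:
  fixes g :: "nat \<Rightarrow> 'a::field poly"
  assumes deg: "\<And>n. degree (g n) = n" and g0: "g 0 \<noteq> 0"
  shows "bij (monom_extend g)"
proof (rule bijI)
  have nz: "g n \<noteq> 0" for n
    using deg[of n] g0 by (cases n) auto
  show "surj (monom_extend g)"
    by (rule linear_op_surjI[OF linear_monom_extend]) (metis monom_extend_monom deg nz)
  have "r = 0" if "monom_extend g r = 0" for r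
  proof -
    \<comment> \<open>For \<open>i\<close> below \<open>degree r\<close> the polynomial
      \<open>g i\<close> has too small a degree to contribute, so the top coefficient is a product
      of two leading coefficients.\<close>
    have "coeff (monom_extend g r) (degree r)
        = (\<Sum>i\<le>degree r. if i = degree r then lead_coeff r * lead_coeff (g i) else 0)"
      unfolding monom_extend_def coeff_sum
      by (rule sum.cong) (auto simp: deg coeff_eq_0)
    then show ?thesis using that nz by simp
  qed
  then show "inj (monom_extend g)"
    using linear_op_diff[OF linear_monom_extend, of g] by (intro injI) (metis eq_iff_diff_eq_0)
qed

section \<open>Operators that lower degrees by exactly one\<close>

text \<open>Common abstraction of the psi-derivative and of delta operators. Subtraction is
  truncated at 0, so the clause on degrees alone would not force constants to be killed; the kernel
  is therefore fixed separately.\<close>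

definition lowers_degree :: "('a::field poly \<Rightarrow> 'a poly) \<Rightarrow> bool" where
  "lowers_degree L \<longleftrightarrow> linear_op L \<and>
     (\<forall>p. degree (L p) = degree p - 1) \<and> (\<forall>p. L p = 0 \<longleftrightarrow> degree p = 0)"

lemma lowers_degreeD:
  assumes "lowers_degree L"
  shows "linear_op L" "degree (L p) = degree p - 1" "L p = 0 \<longleftrightarrow> degree p = 0"
  using assms by (auto simp: lowers_degree_def)

text \<open>A nonzero polynomial loses one degree per application and stays nonzero as long as the
  argument is not constant, so \<open>n\<close> steps end exactly at a nonzero constant.\<close>

lemma lowers_degree_funpow:
  assumes "lowers_degree L" "degree p = n" "p \<noteq> 0"
  shows "\<exists>c. c \<noteq> 0 \<and> (L ^^ n) p = [:c:]"
  using assms(2,3)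
proof (induction n arbitrary: p)
  case 0
  then show ?case by (metis degree_eq_zeroE funpow_0 pCons_0_0)
next
  case (Suc n)
  have "degree (L p) = n" "L p \<noteq> 0"
    using Suc.prems lowers_degreeD[OF assms(1)] by auto
  from Suc.IH[OF this] show ?case by (simp add: funpow_swap1)
qed

lemma lowers_degree_funpow_eq_0:
  assumes "lowers_degree L" "degree p < n"
  shows "(L ^^ n) p = 0"
  using assms(2)
proof (induction n arbitrary: p)
  case (Suc n)
  show ?case
  proof (cases "degree p = 0")
    case True
    then have "L p = 0" using lowers_degreeD[OF assms(1)] by simp
    then show ?thesis
      using linear_op_0[OF linear_op_funpow[OF lowers_degreeD(1)[OF assms(1)]]]
      by (simp add: funpow_swap1)
  next
    case False
    then have "degree (L p) < n" using Suc.prems lowers_degreeD[OF assms(1)] by simp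
    then show ?thesis using Suc.IH by (simp add: funpow_swap1)
  qed
qed simp

lemma surj_lowers_degree:
  assumes "lowers_degree L"
  shows "surj L"
proof (rule linear_op_surjI)
  show "linear_op L" using assms by (rule lowers_degreeD)
  fix n
  have "degree (L (monom 1 (Suc n))) = n" "L (monom 1 (Suc n)) \<noteq> 0"
    using lowers_degreeD[OF assms] by (simp_all add: degree_monom_eq)
  then show "\<exists>u. degree (L u) = n \<and> L u \<noteq> 0" by blast
qed

text \<open>\<open>L\<close> is surjective and its kernel consists of the constants, so prescribing
  the value at 0 singles out one preimage. This is the recursion step for basic sequences.\<close>

lemma lowers_degree_unique_preimage:
  assumes "lowers_degree L"
  shows "\<exists>!p. L p = r \<and> poly p 0 = 0"
proof (rule ex_ex1I)
  note L = lowers_degreeD[OF assms]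
  obtain p where "L p = r" using surj_lowers_degree[OF assms] by (metis surjD)
  moreover have "L [:poly p 0:] = 0" by (simp add: L)
  ultimately have "L (p - [:poly p 0:]) = r \<and> poly (p - [:poly p 0:]) 0 = 0"
    by (simp add: linear_op_diff[OF L(1)])
  then show "\<exists>p. L p = r \<and> poly p 0 = 0" by blast
  fix p p' assume pp: "L p = r \<and> poly p 0 = 0" "L p' = r \<and> poly p' 0 = 0"
  then have "L (p - p') = 0" by (simp add: linear_op_diff[OF L(1)])
  then have "degree (p - p') = 0" by (simp add: L)
  then obtain c where "p - p' = [:c:]" by (rule degree_eq_zeroE)
  moreover have "poly (p - p') 0 = 0" using pp by simp
  ultimately show "p = p'" by simp
qed

section \<open>Expansions of operators in powers of \<open>X\<close> and \<open>L\<close>\<close>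

text \<open>A change of viewpoint: with \<open>X\<close> and \<open>p\<close> fixed, substitution is
  a linear map in \<open>q\<close>, so \<open>bij_monom_extend\<close> becomes applicable to
  it.\<close>

lemma poly_op_conv_monom_extend: "poly_op q X p = monom_extend (\<lambda>i. (X ^^ i) p) q"
  by (simp add: poly_op_def monom_extend_def)

lemma linear_op_poly_op:
  assumes "linear_op X"
  shows "linear_op (poly_op q X)"
proof -
  note X = linear_op_funpow[OF assms]
  show ?thesis
    by (simp add: linear_op_iff poly_op_def linear_op_add[OF X] linear_op_smult[OF X]
        smult_add_right sum.distrib smult_sum_right mult.commute)
qed

context
  fixes L X :: "'a::field poly \<Rightarrow> 'a poly"
  assumes L: "lowers_degree L" and X: "linear_op X"
begin

lemma op_summable_expansion: "op_summable (\<lambda>n. poly_op (q n) X \<circ> (L ^^ n))"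
proof -
  have "{n. (poly_op (q n) X \<circ> (L ^^ n)) p \<noteq> 0} \<subseteq> {..degree p}" for p
    using lowers_degree_funpow_eq_0[OF L] linear_op_0[OF linear_op_poly_op[OF X]]
    by (force simp: not_less[symmetric])
  then show ?thesis unfolding op_summable_def by (meson finite_atMost finite_subset)
qed

text \<open>The terms beyond the degree of \<open>p\<close> vanish. The bound \<open>N\<close> is
  left free so that several polynomials can share one range of summation.\<close>

lemma op_sum_expansion:
  assumes "degree p \<le> N"
  shows "op_sum (\<lambda>n. poly_op (q n) X \<circ> (L ^^ n)) p = (\<Sum>n\<le>N. poly_op (q n) X ((L ^^ n) p))"
proof -
  have "{n. poly_op (q n) X ((L ^^ n) p) \<noteq> 0} \<subseteq> {..N}"
    using lowers_degree_funpow_eq_0[OF L, of p] assms linear_op_0[OF linear_op_poly_op[OF X]]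
    by (force simp: not_less[symmetric])
  then show ?thesis by (simp add: op_sum_def Sum_any.expand_superset)
qed

lemma linear_op_expansion: "linear_op (op_sum (\<lambda>n. poly_op (q n) X \<circ> (L ^^ n)))"
proof -
  let ?S = "op_sum (\<lambda>n. poly_op (q n) X \<circ> (L ^^ n))"
  note lin = linear_op_funpow[OF lowers_degreeD(1)[OF L]] linear_op_poly_op[OF X]
  have "?S (p + r) = ?S p + ?S r" for p r
    by (simp add: op_sum_expansion[where N = "max (degree p) (degree r)"] degree_add_le_max
        linear_op_add[OF lin(1)] linear_op_add[OF lin(2)] sum.distrib)
  moreover have "?S (smult c p) = smult c (?S p)" for c p
    by (simp add: op_sum_expansion[where N = "degree p"] degree_smult_le
        linear_op_smult[OF lin(1)] linear_op_smult[OF lin(2)] smult_sum_right)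
  ultimately show ?thesis by (simp add: linear_op_iff)
qed

lemma unique_expansion:
  assumes deg: "\<And>i. degree ((X ^^ i) 1) = i" and T: "linear_op T"
  shows "\<exists>!q. T = op_sum (\<lambda>n. poly_op (q n) X \<circ> (L ^^ n))"
proof -
  let ?x = "\<lambda>n. monom (1::'a) n"
  \<comment> \<open>\<open>R q n r\<close> is the expansion equation evaluated at the monomial of
    degree \<open>n\<close>, with \<open>r\<close> as the unknown of index \<open>n\<close> and the
    earlier unknowns read off from \<open>q\<close>.\<close>
  define R where "R q n r \<longleftrightarrow>
    T (?x n) = (\<Sum>k<n. poly_op (q k) X ((L ^^ k) (?x n))) + poly_op r X ((L ^^ n) (?x n))"
    for q :: "nat \<Rightarrow> 'a poly" and n r
  have sol: "T = op_sum (\<lambda>n. poly_op (q n) X \<circ> (L ^^ n)) \<longleftrightarrow> (\<forall>n. R q n (q n))" for q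
  proof -
    have "op_sum (\<lambda>n. poly_op (q n) X \<circ> (L ^^ n)) (?x n)
        = (\<Sum>k<n. poly_op (q k) X ((L ^^ k) (?x n))) + poly_op (q n) X ((L ^^ n) (?x n))" for n
      by (simp add: op_sum_expansion[where N = n] degree_monom_eq flip: lessThan_Suc_atMost)
    then show ?thesis
      using linear_op_eqI[OF T linear_op_expansion[of q]] by (auto simp: R_def)
  qed
  \<comment> \<open>The power of \<open>L\<close> turns the monomial into a nonzero constant
    \<open>c\<close>; the polynomials \<open>(X ^^ i) [:c:]\<close> then have degree
    \<open>i\<close> and form a basis.\<close>
  have bij: "bij (\<lambda>r. poly_op r X ((L ^^ n) (?x n)))" for n
  proof -
    obtain c where c: "c \<noteq> 0" "(L ^^ n) (?x n) = [:c:]"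
      using lowers_degree_funpow[OF L, of "?x n" n] by (auto simp: degree_monom_eq)
    have "(X ^^ i) [:c:] = smult c ((X ^^ i) 1)" for i
      using linear_op_smult[OF linear_op_funpow[OF X], of i c 1] by simp
    then show ?thesis
      using c deg by (simp add: poly_op_conv_monom_extend bij_monom_extend)
  qed
  have R_ex1: "\<exists>!r. R q n r" for q n
  proof -
    have "R q n r \<longleftrightarrow>
        poly_op r X ((L ^^ n) (?x n)) = T (?x n) - (\<Sum>k<n. poly_op (q k) X ((L ^^ k) (?x n)))" for r
      by (auto simp: R_def algebra_simps)
    then show ?thesis using bij[of n] by (simp add: bij_iff)
  qed
  have R_cong: "R f n r = R g n r" if "\<And>k. k < n \<Longrightarrow> f k = g k" for f g n r
    using that by (simp add: R_def)
  \<comment> \<open>The system is triangular: the equation of index \<open>n\<close> reads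
    \<open>q\<close> only below \<open>n\<close>, so the solution can be chosen by well-founded
    recursion.\<close>
  have "\<exists>q. \<forall>n. R q n (q n)"
  proof (rule dependent_wf_choice[OF wf_less_than])
    show "R f n r = R g n r" if "\<And>k. (k, n) \<in> less_than \<Longrightarrow> f k = g k" for f g n r
      using that by (intro R_cong) simp
    show "\<exists>r. R f n r" for f n using R_ex1 by blast
  qed
  moreover have "q = q'" if q: "\<forall>n. R q n (q n)" and q': "\<forall>n. R q' n (q' n)" for q q'
  proof
    fix n show "q n = q' n"
    proof (induction n rule: less_induct)
      case (less n)
      then have "R q n (q' n)" using q' R_cong[of n q q'] by blast
      then show ?case using q R_ex1 by blast
    qed
  qed
  ultimately show ?thesis unfolding sol by blast
qed

end

section \<open>The psi-derivative, shift invariance and delta operators\<close>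

lemma linear_op_psi_deriv: "linear_op (psi_deriv \<psi>)"
  unfolding psi_deriv_def by (rule linear_monom_extend)

lemma psi_num_nonzero: "admissible \<psi> \<Longrightarrow> n > 0 \<Longrightarrow> psi_num \<psi> n \<noteq> 0"
  by (simp add: psi_num_def admissible_def)

lemma coeff_psi_deriv: "coeff (psi_deriv \<psi> p) m = psi_num \<psi> (Suc m) * coeff p (Suc m)"
proof -
  \<comment> \<open>The bound \<open>Suc (degree p + m)\<close> covers both the degree of
    \<open>p\<close> and the index \<open>Suc m\<close>.\<close>
  have "coeff (psi_deriv \<psi> p) m = (\<Sum>i\<le>Suc (degree p + m). coeff (smult (coeff p i)
      (monom (psi_num \<psi> i) (i - 1))) m)"
    unfolding psi_deriv_def
    by (subst monom_extend_altdef[where N = "Suc (degree p + m)"]) (simp_all add: coeff_sum)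
  also have "\<dots> = (\<Sum>i\<le>Suc (degree p + m).
      if i = Suc m then psi_num \<psi> (Suc m) * coeff p (Suc m) else 0)"
    \<comment> \<open>For \<open>i = 0\<close> the truncated exponent \<open>i - 1\<close> is 0 and
      would also match \<open>m = 0\<close>; the value \<open>psi_num \<psi> 0 = 0\<close> removes
      this term.\<close>
    by (rule sum.cong) (auto simp: psi_num_def)
  finally show ?thesis by simp
qed

lemma lowers_degree_psi_deriv:
  assumes "admissible \<psi>"
  shows "lowers_degree (psi_deriv \<psi>)"
proof -
  have zero: "psi_deriv \<psi> p = 0 \<longleftrightarrow> degree p = 0" for p
  proof
    assume "degree p = 0"
    then show "psi_deriv \<psi> p = 0" by (simp add: poly_eq_iff coeff_psi_deriv coeff_eq_0)
  next
    assume "psi_deriv \<psi> p = 0"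
    then have "coeff (psi_deriv \<psi> p) (degree p - 1) = 0" by simp
    then show "degree p = 0"
      using psi_num_nonzero[OF assms, of "degree p"] leading_coeff_0_iff[of p]
      by (cases "degree p") (auto simp: coeff_psi_deriv simp del: leading_coeff_0_iff)
  qed
  moreover have "degree (psi_deriv \<psi> p) = degree p - 1" for p
  proof (cases "degree p")
    case (Suc n)
    have "degree (psi_deriv \<psi> p) \<le> n"
      by (rule degree_le) (use Suc in \<open>auto simp: coeff_psi_deriv coeff_eq_0\<close>)
    moreover have "coeff (psi_deriv \<psi> p) n \<noteq> 0"
      using Suc psi_num_nonzero[OF assms, of "Suc n"]
      by (metis coeff_psi_deriv leading_coeff_0_iff degree_0 mult_eq_0_iff nat.distinct(1) zero_less_Suc)
    ultimately show ?thesis using Suc le_degree by fastforce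
  next
    case 0
    then have "psi_deriv \<psi> p = 0" by (simp only: zero)
    then show ?thesis using 0 by simp
  qed
  ultimately show ?thesis by (simp add: lowers_degree_def linear_op_psi_deriv)
qed

lemma psi_translation_eq_sum:
  assumes "admissible \<psi>" "degree p \<le> N"
  shows "psi_translation \<psi> a p = (\<Sum>k\<le>N. smult (a ^ k / psi_fact \<psi> k) ((psi_deriv \<psi> ^^ k) p))"
proof -
  have "{k. smult (a ^ k / psi_fact \<psi> k) ((psi_deriv \<psi> ^^ k) p) \<noteq> 0} \<subseteq> {..N}"
    using lowers_degree_funpow_eq_0[OF lowers_degree_psi_deriv[OF assms(1)], of p] assms(2)
    by (force simp: not_less[symmetric])
  then show ?thesis by (simp add: psi_translation_def op_sum_def Sum_any.expand_superset)
qed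

text \<open>For fixed \<open>p\<close> and \<open>m\<close>, the coefficients of index
  \<open>m\<close> on both sides of the invariance equation are polynomials in \<open>a\<close>.
  They agree for all \<open>a\<close> in an infinite field, hence coefficientwise; the linear
  coefficient gives the commutation.\<close>

lemma psi_shift_invariant_commutes:
  fixes \<psi> :: "nat \<Rightarrow> 'a::field_char_0"
  assumes adm: "admissible \<psi>" and inv: "psi_shift_invariant \<psi> Q"
  shows "Q (psi_deriv \<psi> p) = psi_deriv \<psi> (Q p)"
proof (rule poly_eqI)
  fix m
  let ?D = "psi_deriv \<psi>"
  have Q: "linear_op Q" and comm: "Q (psi_translation \<psi> a p) = psi_translation \<psi> a (Q p)" for a
    using inv by (auto simp: psi_shift_invariant_def fun_eq_iff)
  \<comment> \<open>The \<open>Suc\<close> guarantees that the index \<open>k = 1\<close> lies in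
    the range of summation.\<close>
  define N where "N = Suc (max (degree p) (degree (Q p)))"
  define d where "d k = (coeff (Q ((?D ^^ k) p)) m - coeff ((?D ^^ k) (Q p)) m) / psi_fact \<psi> k" for k
  \<comment> \<open>\<open>h\<close> is the difference of the two sides as a polynomial in
    \<open>a\<close>.\<close>
  define h where "h = (\<Sum>k\<le>N. monom (d k) k)"
  have "poly h a = 0" for a
  proof -
    have "coeff (Q (psi_translation \<psi> a p)) m
        = (\<Sum>k\<le>N. a ^ k / psi_fact \<psi> k * coeff (Q ((?D ^^ k) p)) m)"
      by (subst psi_translation_eq_sum[OF adm, where N = N])
        (simp_all add: N_def linear_op_sum[OF Q] linear_op_smult[OF Q] coeff_sum del: sum.atMost_Suc)
    moreover have "coeff (psi_translation \<psi> a (Q p)) m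
        = (\<Sum>k\<le>N. a ^ k / psi_fact \<psi> k * coeff ((?D ^^ k) (Q p)) m)"
      by (subst psi_translation_eq_sum[OF adm, where N = N])
        (simp_all add: N_def coeff_sum del: sum.atMost_Suc)
    moreover have "poly h a = (\<Sum>k\<le>N. a ^ k / psi_fact \<psi> k * coeff (Q ((?D ^^ k) p)) m)
        - (\<Sum>k\<le>N. a ^ k / psi_fact \<psi> k * coeff ((?D ^^ k) (Q p)) m)"
      by (simp add: h_def poly_sum poly_monom d_def diff_divide_distrib algebra_simps
          flip: sum_subtractf)
    ultimately show ?thesis using comm by simp
  qed
  then have "h = 0" using poly_all_0_iff_0 by blast
  then have "coeff h 1 = 0" by simp
  then have "d 1 = 0" by (simp add: h_def coeff_sum coeff_monom N_def del: sum.atMost_Suc)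
  moreover have "psi_fact \<psi> 1 \<noteq> 0"
    using psi_fact_eq_inverse[OF adm] adm by (simp add: admissible_def)
  ultimately show "coeff (Q (?D p)) m = coeff (?D (Q p)) m" by (simp add: d_def)
qed

lemma lowers_degree_psi_delta_operator:
  fixes \<psi> :: "nat \<Rightarrow> 'a::field_char_0"
  assumes adm: "admissible \<psi>" and delta: "psi_delta_operator \<psi> Q"
  shows "lowers_degree Q"
proof -
  let ?D = "psi_deriv \<psi>"
  note D = lowers_degreeD[OF lowers_degree_psi_deriv[OF adm]]
  have comm: "Q (?D p) = ?D (Q p)" for p
    using psi_shift_invariant_commutes[OF adm] delta by (simp add: psi_delta_operator_def)
  obtain c where Q: "linear_op Q" and c: "c \<noteq> 0" "Q [:0, 1:] = [:c:]"
    using delta by (auto simp: psi_delta_operator_def psi_shift_invariant_def)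
  obtain e where e: "e \<noteq> 0" "?D [:0, 1:] = [:e:]"
    using lowers_degree_funpow[OF lowers_degree_psi_deriv[OF adm], of "[:0,1:]" 1] by auto
  \<comment> \<open>Every constant is a multiple of \<open>?D [:0, 1:]\<close>; commuting
    \<open>Q\<close> past \<open>?D\<close> leaves the derivative of the constant
    \<open>Q [:0, 1:]\<close>, which is 0.\<close>
  have "Q [:e:] = ?D [:c:]" using comm[of "[:0,1:]"] by (simp add: e c)
  also have "\<dots> = 0" by (simp add: D)
  finally have Q_const: "Q [:b:] = 0" for b
    using linear_op_smult[OF Q, of "b / e" "[:e:]"] e by simp
  \<comment> \<open>Induction along \<open>?D\<close>: it lowers the degree of \<open>p\<close>, and
    since \<open>?D (Q p) = Q (?D p)\<close>, the degree of \<open>Q p\<close> is one more than the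
    degree known for \<open>Q (?D p)\<close>. The base case is the value of \<open>Q\<close> at
    linear polynomials.\<close>
  have step: "degree (Q p) = n \<and> Q p \<noteq> 0" if "degree p = Suc n" for n p
    using that
  proof (induction n arbitrary: p)
    case 0
    then obtain a b where p: "p = [:b, a:]" "a \<noteq> 0"
      by (cases p rule: pCons_cases) (auto split: if_splits elim: degree_eq_zeroE)
    have "Q p = Q ([:b:] + smult a [:0, 1:])" by (simp add: p)
    also have "\<dots> = [:a * c:]"
      unfolding linear_op_add[OF Q] linear_op_smult[OF Q] by (simp add: Q_const c)
    finally show ?case using p c by simp
  next
    case (Suc n)
    then have "degree (?D p) = Suc n" by (simp add: D)
    from Suc.IH[OF this] have "degree (?D (Q p)) = n" "?D (Q p) \<noteq> 0" by (simp_all add: comm)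
    then have "degree (Q p) - 1 = n" "degree (Q p) \<noteq> 0" by (simp_all add: D)
    then show ?case by auto
  qed
  have "degree (Q p) = degree p - 1 \<and> (Q p = 0 \<longleftrightarrow> degree p = 0)" for p
  proof (cases "degree p")
    case 0
    then show ?thesis by (metis Q_const degree_0 degree_eq_zeroE diff_0_eq_0)
  qed (use step in auto)
  then show ?thesis using Q by (simp add: lowers_degree_def)
qed

section \<open>Basic sequences and the dual operator\<close>

lemma ex1_psi_basic_seq:
  assumes adm: "admissible \<psi>" and L: "lowers_degree Q"
  shows "\<exists>!p. is_psi_basic_seq \<psi> Q p"
proof (rule ex_ex1I)
  note QD = lowers_degreeD[OF L]
  define pre where "pre r = (THE p. Q p = r \<and> poly p 0 = 0)" for r
  have pre: "Q (pre r) = r \<and> poly (pre r) 0 = 0" for r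
    unfolding pre_def using lowers_degree_unique_preimage[OF L] by (rule theI')
  define p where "p = rec_nat 1 (\<lambda>n r. pre (smult (psi_num \<psi> (Suc n)) r))"
  have p0: "p 0 = 1" and pS: "p (Suc n) = pre (smult (psi_num \<psi> (Suc n)) (p n))" for n
    by (simp_all add: p_def)
  have QS: "Q (p (Suc n)) = smult (psi_num \<psi> (Suc n)) (p n)" for n
    by (simp add: pS pre)
  have "degree (p n) = n \<and> p n \<noteq> 0" for n
  proof (induction n)
    case (Suc n)
    then have "degree (Q (p (Suc n))) = n" "Q (p (Suc n)) \<noteq> 0"
      using psi_num_nonzero[OF adm, of "Suc n"] by (simp_all add: QS)
    \<comment> \<open>Truncated subtraction does not separate degrees 0 and 1 when
      \<open>n = 0\<close>; that \<open>Q (p (Suc n))\<close> is nonzero excludes degree 0.\<close>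
    then have "degree (p (Suc n)) - 1 = n" "degree (p (Suc n)) \<noteq> 0" by (simp_all add: QD)
    then show ?case by auto
  qed (simp add: p0)
  moreover have "Q (p n) = smult (psi_num \<psi> n) (p (n - 1))" for n
    by (cases n) (simp_all add: QS p0 QD psi_num_def)
  moreover have "poly (p n) 0 = 0" if "n > 0" for n
    using that by (cases n) (simp_all add: pS pre)
  ultimately show "\<exists>p. is_psi_basic_seq \<psi> Q p"
    using p0 unfolding is_psi_basic_seq_def by blast
next
  fix p p' assume p: "is_psi_basic_seq \<psi> Q p" "is_psi_basic_seq \<psi> Q p'"
  show "p = p'"
  proof
    fix n show "p n = p' n"
    proof (induction n)
      case 0
      show ?case using p by (simp add: is_psi_basic_seq_def)
    next
      case (Suc n)
      have "Q (p (Suc n)) = Q (p' (Suc n)) \<and> poly (p (Suc n)) 0 = 0 \<and> poly (p' (Suc n)) 0 = 0"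
        using p Suc by (simp add: is_psi_basic_seq_def)
      then show ?case using lowers_degree_unique_preimage[OF L] by metis
    qed
  qed
qed

lemma is_psi_basic_seq_psi_basic_seq:
  assumes "admissible \<psi>" "lowers_degree Q"
  shows "is_psi_basic_seq \<psi> Q (psi_basic_seq \<psi> Q)"
  unfolding psi_basic_seq_def using ex1_psi_basic_seq[OF assms] by (rule theI')

text \<open>The family \<open>g\<close> is a basis, so pass to monomial coordinates by the inverse
  of \<open>monom_extend g\<close> and extend \<open>f\<close> linearly from there.\<close>

lemma ex1_linear_op_on_basis:
  fixes g f :: "nat \<Rightarrow> 'a::field poly"
  assumes "\<And>n. degree (g n) = n" "g 0 \<noteq> 0"
  shows "\<exists>!X. linear_op X \<and> (\<forall>n. X (g n) = f n)"
proof (rule ex_ex1I)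
  let ?M = "monom_extend g"
  note M = linear_monom_extend[of g]
  have bij: "bij ?M" using assms by (rule bij_monom_extend)
  have inv: "?M (inv ?M p) = p" "inv ?M (?M p) = p" for p
    using bij by (simp_all add: bij_is_surj surj_f_inv_f bij_is_inj)
  have "linear_op (inv ?M)"
    unfolding linear_op_iff by (metis inv linear_op_add[OF M] linear_op_smult[OF M])
  then have "linear_op (monom_extend f \<circ> inv ?M)"
    using linear_monom_extend[of f] by (simp add: linear_op_iff)
  moreover have "inv ?M (g n) = monom 1 n" for n
    using inv(2)[of "monom 1 n"] by simp
  ultimately show "\<exists>X. linear_op X \<and> (\<forall>n. X (g n) = f n)"
    by (intro exI[of _ "monom_extend f \<circ> inv ?M"]) simp
  fix X Y assume XY: "linear_op X \<and> (\<forall>n. X (g n) = f n)" "linear_op Y \<and> (\<forall>n. Y (g n) = f n)"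
  have "X \<circ> ?M = Y \<circ> ?M"
    by (rule linear_op_eqI) (use XY M in \<open>simp_all add: linear_op_iff\<close>)
  then have "X (?M r) = Y (?M r)" for r by (simp add: fun_eq_iff)
  \<comment> \<open>Every polynomial is a value of \<open>?M\<close>, so agreement on the range is
    agreement everywhere.\<close>
  from this[of "inv ?M _"] show "X = Y" by (auto simp: inv(1))
qed

text \<open>The basic sequence is a basis, so the definite description of the dual operator is
  proper and its defining equations may be used.\<close>

lemma dual_op:
  fixes Q :: "'a::field poly \<Rightarrow> 'a poly"
  assumes "admissible \<psi>" "lowers_degree Q"
  shows "linear_op (dual_op \<psi> Q)"
    and "dual_op \<psi> Q (psi_basic_seq \<psi> Q n) =
      smult (of_nat (n + 1) / psi_num \<psi> (n + 1)) (psi_basic_seq \<psi> Q (n + 1))"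
proof -
  let ?p = "psi_basic_seq \<psi> Q"
  have "\<And>n. degree (?p n) = n" "?p 0 \<noteq> 0"
    using is_psi_basic_seq_psi_basic_seq[OF assms] by (simp_all add: is_psi_basic_seq_def)
  from theI'[OF ex1_linear_op_on_basis[OF this,
      of "\<lambda>n. smult (of_nat (n + 1) / psi_num \<psi> (n + 1)) (?p (n + 1))"]]
  show "linear_op (dual_op \<psi> Q)"
    "dual_op \<psi> Q (?p n) = smult (of_nat (n + 1) / psi_num \<psi> (n + 1)) (?p (n + 1))"
    unfolding dual_op_def by blast+
qed

text \<open>Starting from \<open>1\<close>, the first basic polynomial, each application of the dual
  operator moves to the next one up to a nonzero factor.\<close>

lemma degree_funpow_dual_op:
  fixes Q :: "'a::field_char_0 poly \<Rightarrow> 'a poly"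
  assumes "admissible \<psi>" "lowers_degree Q"
  shows "degree ((dual_op \<psi> Q ^^ i) 1) = i"
proof -
  let ?p = "psi_basic_seq \<psi> Q"
  have p: "degree (?p n) = n" "?p 0 = 1" for n
    using is_psi_basic_seq_psi_basic_seq[OF assms] by (simp_all add: is_psi_basic_seq_def)
  have "\<exists>d. d \<noteq> 0 \<and> (dual_op \<psi> Q ^^ i) 1 = smult d (?p i)"
  proof (induction i)
    case 0
    show ?case by (intro exI[of _ 1]) (simp add: p)
  next
    case (Suc i)
    then obtain d where d: "d \<noteq> 0" "(dual_op \<psi> Q ^^ i) 1 = smult d (?p i)" by blast
    show ?case
      \<comment> \<open>The new factor is nonzero because \<open>i + 1\<close> does not vanish in
        characteristic zero.\<close>
      by (intro exI[of _ "d * (of_nat (i + 1) / psi_num \<psi> (i + 1))"])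
        (use d psi_num_nonzero[OF assms(1), of "i + 1"] in
          \<open>simp add: linear_op_smult[OF dual_op(1)[OF assms]] dual_op(2)[OF assms] del: of_nat_Suc\<close>)
  qed
  then show ?thesis using p by auto
qed

theorem proposition3p3:
  fixes \<psi> :: "nat \<Rightarrow> 'a::field_char_0" and Q :: "'a poly \<Rightarrow> 'a poly"
  assumes "admissible \<psi>" and "psi_delta_operator \<psi> Q"
  shows "(\<forall>q :: nat \<Rightarrow> 'a poly.
            op_summable (\<lambda>n. poly_op (q n) (dual_op \<psi> Q) \<circ> (Q ^^ n)) \<and>
            linear_op (op_sum (\<lambda>n. poly_op (q n) (dual_op \<psi> Q) \<circ> (Q ^^ n)))) \<and>
         (\<forall>T. linear_op T \<longrightarrow>
            (\<exists>!q :: nat \<Rightarrow> 'a poly.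
               op_summable (\<lambda>n. poly_op (q n) (dual_op \<psi> Q) \<circ> (Q ^^ n)) \<and>
               T = op_sum (\<lambda>n. poly_op (q n) (dual_op \<psi> Q) \<circ> (Q ^^ n))))"
proof -
  have L: "lowers_degree Q"
    using assms by (rule lowers_degree_psi_delta_operator)
  note X = dual_op(1)[OF assms(1) L]
  show ?thesis
    \<comment> \<open>Summability holds for every \<open>q\<close>, so the conjunction under the
      unique existence reduces to the operator equation.\<close>
    using op_summable_expansion[OF L X] linear_op_expansion[OF L X]
      unique_expansion[OF L X degree_funpow_dual_op[OF assms(1) L]]
    by simp
qed

end
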